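(* Let $P_1,\ldots,P_N$ be discrete probability measures on $\mathbb{R}^d$, and let $S_i=|\operatorname{supp}(P_i)|$ for $i=1,\ldots,N$. Then there exists a Wasserstein barycenter $\bar{P}$ of $P_1,\ldots,P_N$ such that $$|\operatorname{supp}(\bar{P})|\leq\sum_{i=1}^N S_i-N+1.$$
   Context: A discrete probability measure on $\mathbb{R}^d$ is a probability measure with finite support. $\mathcal{P}^2(\mathbb{R}^d)$ is the set of all probability measures on $\mathbb{R}^d$ with finite second moments. $W_2$ is the quadratic Wasserstein distance: $W_2(P,Q)^2=\inf E|X-Y|^2$ over all couplings $(X,Y)$ with $X\sim P$, $Y\sim Q$, with $|\cdot|$ the Euclidean norm. A (Wasserstein) barycenter of $P_1,\ldots,P_N$ is any $\bar P\in\mathcal{P}^2(\mathbb{R}^d)$ with $\sum_{i=1}^N W_2(\bar P,P_i)^2=\inf_{P\in\mathcal{P}^2(\mathbb{R}^d)}\sum_{i=1}^N W_2(P,P_i)^2$. *)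

theory Defs
  imports "HOL-Probability.Probability"
begin

text \<open>Borel probability measures are represented by values \<open>M\<close> of type \<open>'a measure\<close> with
  \<open>prob_space M\<close> and \<open>sets M = sets borel\<close>.\<close>

definition prob_measures :: "'a::topological_space measure set" where
  "prob_measures = {M. prob_space M \<and> sets M = sets borel}"

text \<open>The topological support. It is closed, and it has full measure for Borel probability
  measures on a second-countable space.\<close>

definition measure_support :: "'a::topological_space measure \<Rightarrow> 'a set" where
  "measure_support M = {x. \<forall>U. open U \<longrightarrow> x \<in> U \<longrightarrow> emeasure M U > 0}"

definition discrete_prob_measure :: "'a::topological_space measure \<Rightarrow> bool" where
  "discrete_prob_measure M \<longleftrightarrow> M \<in> prob_measures \<and> finite (measure_support M)"

definition P2 :: "'a::euclidean_space measure set" where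
  "P2 = {M \<in> prob_measures. integrable M (\<lambda>x. (norm x)\<^sup>2)}"

text \<open>A coupling \<open>(X, Y)\<close> is represented by its joint law; \<open>E |X - Y|\<^sup>2\<close> depends on nothing else.\<close>

definition couplings ::
  "'a::euclidean_space measure \<Rightarrow> 'a measure \<Rightarrow> ('a \<times> 'a) measure set" where
  "couplings P Q =
     {\<gamma> \<in> prob_measures. distr \<gamma> borel fst = P \<and> distr \<gamma> borel snd = Q}"

text \<open>The infimum is taken in \<open>ennreal\<close>, where a divergent cost is \<open>\<infinity>\<close>. For \<open>P\<close> and \<open>Q\<close> in \<open>P2\<close>
  it is finite, so the conversion to \<open>real\<close> loses nothing there. Outside \<open>P2\<close> the value may be
  an artefact of \<open>enn2real \<infinity> = 0\<close>.\<close>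

definition W2 :: "'a::euclidean_space measure \<Rightarrow> 'a measure \<Rightarrow> real" where
  "W2 P Q =
     sqrt (enn2real (INF \<gamma>\<in>couplings P Q. \<integral>\<^sup>+ (x, y). ennreal ((norm (x - y))\<^sup>2) \<partial>\<gamma>))"

text \<open>The real-valued infimum below is over a nonempty set of nonnegative numbers.\<close>

definition is_barycenter ::
  "nat \<Rightarrow> (nat \<Rightarrow> 'a::euclidean_space measure) \<Rightarrow> 'a measure \<Rightarrow> bool" where
  "is_barycenter N P B \<longleftrightarrow>
     B \<in> P2 \<and>
     (\<Sum>i=1..N. (W2 B (P i))\<^sup>2) = (INF Q\<in>P2. \<Sum>i=1..N. (W2 Q (P i))\<^sup>2)"

end

theory Submission
  imports Defs
begin

text \<open>
  A barycenter problem for measures with finite support is a finite linear program in disguise, and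
  the bound on the support is the bound on the number of nonzero entries of a basic solution.

  Let \<open>S i\<close> be the support of \<open>P i\<close>. A \<^emph>\<open>plan\<close> is a weight \<open>w\<close> on the tuples \<open>k\<close> that choose one point
  \<open>k i \<in> S i\<close> for each \<open>i\<close>, with marginals \<open>P i\<close>. Its cost is the sum of \<open>w k * dispersion k\<close>, where
  the dispersion of a tuple is its sum of squared distances to its own mean. Both directions between
  plans and measures lose nothing:

  \<^item> A plan gives the law \<open>B\<close> of the mean of a \<open>w\<close>-random tuple. The pair of the mean and the \<open>i\<close>-th
    point couples \<open>B\<close> with \<open>P i\<close>, so \<open>B\<close> has total squared distance at most the cost of \<open>w\<close>, and its
    support has at most as many points as \<open>w\<close> has nonzero entries (\<open>mean_of_plan\<close>).

  \<^item> Given any \<open>Q\<close> and couplings of \<open>Q\<close> with the \<open>P i\<close>, draw \<open>y\<close> from \<open>Q\<close> and then the points \<open>k i\<close>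
    independently from the conditional laws given \<open>y\<close>. The law of \<open>k\<close> is a plan, and it costs at most
    the sum of the coupling costs, because no point \<open>y\<close> is closer to \<open>k\<close> in total square than the mean
    of \<open>k\<close> (\<open>glue_couplings\<close>, \<open>dispersion_le\<close>). As \<open>P i\<close> has finite support, the conditional laws are
    just Radon-Nikodym densities, one for each point of \<open>S i\<close> (\<open>coupling_conditional_weights\<close>).

  So the mean of an optimal plan is a barycenter. The linear program has an optimal solution with at
  most as many nonzero entries as equations (\<open>lp_optimal_sparse_solution\<close>). There is one equation for
  each point of each \<open>S i\<close>, but each of the \<open>N\<close> families of equations fixes the same total mass, so one
  equation in all but one of the families is redundant. This leaves \<open>\<Sum>i. card (S i) - N + 1\<close> of them
  (\<open>multimarginal_optimal_sparse_plan\<close>).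
\<close>

section \<open>Sparse optimal solutions of finite linear programs\<close>

text \<open>Gaussian elimination: one equation is solved for one unknown and substituted into the others.
  Stating this for functions on finite sets rather than for vectors keeps the number of unknowns a
  plain cardinality.\<close>

lemma homogeneous_system_nontrivial_solution:
  fixes a :: "'e \<Rightarrow> 'k \<Rightarrow> 'f::field"
  assumes "finite E" "finite T" "card E < card T"
  shows "\<exists>v. (\<forall>k. k \<notin> T \<longrightarrow> v k = 0) \<and> (\<exists>k\<in>T. v k \<noteq> 0) \<and>
             (\<forall>e\<in>E. (\<Sum>k\<in>T. a e k * v k) = 0)"
  using assms
proof (induction E arbitrary: T a rule: finite_induct)
  case empty
  then obtain t where "t \<in> T" by fastforce
  then show ?case by (intro exI[of _ "\<lambda>k. if k = t then 1 else 0"]) auto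
next
  case (insert e E)
  show ?case
  proof (cases "\<forall>t\<in>T. a e t = 0")
    case True
    have "card E < card T" using insert by simp
    then obtain v where "\<forall>k. k \<notin> T \<longrightarrow> v k = 0" "\<exists>k\<in>T. v k \<noteq> 0"
      "\<forall>e\<in>E. (\<Sum>k\<in>T. a e k * v k) = 0"
      using insert.IH[of T a] insert.prems(1) by auto
    with True show ?thesis by (intro exI[of _ v]) auto
  next
    case False
    then obtain t where t: "t \<in> T" "a e t \<noteq> 0" by blast
    \<comment> \<open>The coefficients left after eliminating the unknown \<open>t\<close> by means of equation \<open>e\<close>.\<close>
    define a' where "a' e' k = a e' k - a e' t * a e k / a e t" for e' k
    have "card E < card (T - {t})" using insert t by simp
    then obtain v where v: "\<forall>k. k \<notin> T - {t} \<longrightarrow> v k = 0" "\<exists>k\<in>T - {t}. v k \<noteq> 0"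
      "\<forall>e\<in>E. (\<Sum>k\<in>T - {t}. a' e k * v k) = 0"
      using insert.IH[of "T - {t}" a'] insert.prems(1) by auto
    define r where "r = - (\<Sum>k\<in>T - {t}. a e k * v k) / a e t"
    define v' where "v' = v(t := r)"
    have split: "(\<Sum>k\<in>T. a e' k * v' k) = a e' t * r + (\<Sum>k\<in>T - {t}. a e' k * v k)" for e'
      using t insert.prems by (subst sum.remove[of T t]) (auto simp: v'_def intro!: sum.cong)
    have "(\<Sum>k\<in>T. a e' k * v' k) = 0" if "e' \<in> insert e E" for e'
    proof (cases "e' = e")
      case True
      then show ?thesis using split t by (simp add: r_def)
    next
      case False
      with that v have "0 = (\<Sum>k\<in>T - {t}. a' e' k * v k)" by simp
      also have "\<dots> = (\<Sum>k\<in>T - {t}. a e' k * v k - (a e' t / a e t) * (a e k * v k))"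
        by (intro sum.cong) (auto simp: a'_def algebra_simps)
      also have "\<dots> = (\<Sum>k\<in>T. a e' k * v' k)"
        by (simp add: split sum_subtractf r_def flip: sum_distrib_left sum_divide_distrib)
      finally show ?thesis by simp
    qed
    with v t show ?thesis by (intro exI[of _ v']) (auto simp: v'_def)
  qed
qed

text \<open>Weights are required to vanish off \<open>K\<close>, so that a feasible point is determined by its values on
  \<open>K\<close> and equality of feasible points is equality of functions.\<close>

definition lp_feasible :: "'k set \<Rightarrow> 'e set \<Rightarrow> ('e \<Rightarrow> 'k \<Rightarrow> real) \<Rightarrow> ('e \<Rightarrow> real) \<Rightarrow> ('k \<Rightarrow> real) \<Rightarrow> bool" where
  "lp_feasible K E a b w \<longleftrightarrow> (\<forall>k. 0 \<le> w k) \<and> (\<forall>k. k \<notin> K \<longrightarrow> w k = 0) \<and>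
     (\<forall>e\<in>E. (\<Sum>k\<in>K. a e k * w k) = b e)"

text \<open>A feasible point whose support \<open>T\<close> has this property is a basic solution, that is, a vertex of the
  feasible polytope.\<close>

definition independent_columns :: "'k set \<Rightarrow> 'e set \<Rightarrow> ('e \<Rightarrow> 'k \<Rightarrow> real) \<Rightarrow> 'k set \<Rightarrow> bool" where
  "independent_columns K E a T \<longleftrightarrow>
     (\<forall>v. (\<forall>k. k \<notin> T \<longrightarrow> v k = 0) \<longrightarrow> (\<forall>e\<in>E. (\<Sum>k\<in>K. a e k * v k) = 0) \<longrightarrow> (\<forall>k. v k = 0))"

lemma independent_columns_card_le:
  assumes "finite K" "finite E" "T \<subseteq> K" "independent_columns K E a T"
  shows "card T \<le> card E"
proof (rule ccontr)
  assume "\<not> card T \<le> card E"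
  moreover have "finite T" using assms finite_subset by blast
  ultimately obtain v where v: "\<forall>k. k \<notin> T \<longrightarrow> v k = 0" "\<exists>k\<in>T. v k \<noteq> 0"
      "\<forall>e\<in>E. (\<Sum>k\<in>T. a e k * v k) = 0"
    using homogeneous_system_nontrivial_solution[of E T a] assms(2) by auto
  have "(\<Sum>k\<in>K. a e k * v k) = (\<Sum>k\<in>T. a e k * v k)" for e
    using assms v by (intro sum.mono_neutral_right) auto
  with v assms(4) show False unfolding independent_columns_def by metis
qed

text \<open>A linear relation \<open>v\<close> between the columns in the support of \<open>w\<close> can be added to \<open>w\<close> in either
  direction. Moving in a direction that does not raise the cost until an entry reaches zero gives a
  smaller support. Nonnegative costs ensure that such a direction has a negative entry, hence that
  the motion stops.\<close>

lemma lp_reduce_to_independent_support: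
  assumes K: "finite K" and c: "\<And>k. k \<in> K \<Longrightarrow> 0 \<le> c k" and w: "lp_feasible K E a b w"
  shows "\<exists>w'. lp_feasible K E a b w' \<and> independent_columns K E a {k. w' k \<noteq> 0} \<and>
              (\<Sum>k\<in>K. c k * w' k) \<le> (\<Sum>k\<in>K. c k * w k)"
  using w
proof (induction "card {k. w k \<noteq> 0}" arbitrary: w rule: less_induct)
  case less
  let ?T = "{k. w k \<noteq> 0}"
  have w: "\<And>k. 0 \<le> w k" "\<And>k. k \<notin> K \<Longrightarrow> w k = 0" "\<And>e. e \<in> E \<Longrightarrow> (\<Sum>k\<in>K. a e k * w k) = b e"
    using less.prems by (auto simp: lp_feasible_def)
  have T: "?T \<subseteq> K" "finite ?T" using w(2) K by (auto intro: finite_subset)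
  show ?case
  proof (cases "independent_columns K E a ?T")
    case True
    with less.prems show ?thesis by blast
  next
    case False
    then obtain u x where u: "\<And>k. w k = 0 \<Longrightarrow> u k = 0"
      "\<And>e. e \<in> E \<Longrightarrow> (\<Sum>k\<in>K. a e k * u k) = 0" "u x \<noteq> 0"
      by (auto simp: independent_columns_def)
    \<comment> \<open>If the cost strictly decreases along \<open>v\<close>, then nonnegativity of \<open>c\<close> forces a negative entry; if the cost is constant along \<open>v\<close>, the sign is free.\<close>
    obtain v y where v: "\<And>k. w k = 0 \<Longrightarrow> v k = 0" "\<And>e. e \<in> E \<Longrightarrow> (\<Sum>k\<in>K. a e k * v k) = 0"
      "v y < 0" "(\<Sum>k\<in>K. c k * v k) \<le> 0"
    proof -
      have neg: "(\<And>e. e \<in> E \<Longrightarrow> (\<Sum>k\<in>K. a e k * - u k) = 0)" "(\<Sum>k\<in>K. c k * - u k) = - (\<Sum>k\<in>K. c k * u k)"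
        using u(2) by (simp_all add: sum_negf)
      have pos: "(\<Sum>k\<in>K. c k * r k) \<ge> 0" if "\<forall>k. 0 \<le> r k" for r
        using c that by (auto intro!: sum_nonneg)
      consider "(\<Sum>k\<in>K. c k * u k) = 0" | "(\<Sum>k\<in>K. c k * u k) < 0" | "(\<Sum>k\<in>K. c k * u k) > 0"
        by linarith
      then show ?thesis
      proof cases
        case 1
        show ?thesis
        proof (cases "u x < 0")
          case True
          with 1 u show ?thesis by (intro that[of u x]) auto
        next
          case False
          with 1 u neg show ?thesis by (intro that[of "\<lambda>k. - u k" x]) auto
        qed
      next
        case 2
        then have "\<not> (\<forall>k. 0 \<le> u k)" using pos[of u] by (meson not_less)
        then obtain y where "u y < 0" by (auto simp: not_le)
        with 2 u show ?thesis by (intro that[of u y]) auto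
      next
        case 3
        then have "\<not> (\<forall>k. 0 \<le> - u k)" using pos[of "\<lambda>k. - u k"] unfolding neg(2) by (meson neg_0_le_iff_le not_less)
        then obtain y where "- u y < 0" by (auto simp: not_le)
        with 3 u neg show ?thesis by (intro that[of "\<lambda>k. - u k" y]) auto
      qed
    qed
    define R where "R = {k. v k < 0}"
    have R: "R \<subseteq> ?T" "y \<in> R" using v by (auto simp: R_def)
    then have "finite R" using T finite_subset by blast
    then obtain z where z: "z \<in> R" "\<And>k. k \<in> R \<Longrightarrow> w z / - v z \<le> w k / - v k"
      using R(2) ex_is_arg_min_if_finite[of R "\<lambda>k. w k / - v k"]
      by (auto simp: is_arg_min_linorder)
    \<comment> \<open>The largest step that keeps all entries nonnegative; the entry at \<open>z\<close> becomes zero.\<close>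
    define t where "t = w z / - v z"
    have vz: "v z < 0" using z by (simp add: R_def)
    have t: "t \<ge> 0" unfolding t_def using vz w(1)[of z] by (intro divide_nonneg_pos) auto
    define w' where "w' k = w k + t * v k" for k
    have "0 \<le> w' k" for k
    proof (cases "v k < 0")
      case True
      then have "t \<le> w k / - v k" using z(2) by (simp add: t_def R_def)
      with True show ?thesis by (simp add: w'_def field_simps)
    next
      case False
      then show ?thesis using t w(1) by (simp add: w'_def)
    qed
    moreover have "(\<Sum>k\<in>K. a e k * w' k) = (\<Sum>k\<in>K. a e k * w k) + t * (\<Sum>k\<in>K. a e k * v k)" for e
      by (simp add: w'_def sum_distrib_left algebra_simps flip: sum.distrib)
    ultimately have feas: "lp_feasible K E a b w'"
      using w v by (auto simp: lp_feasible_def w'_def)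
    have "w' z = 0" "w z \<noteq> 0" using vz v(1)[of z] by (auto simp: w'_def t_def)
    moreover have "{k. w' k \<noteq> 0} \<subseteq> ?T" using v by (auto simp: w'_def)
    ultimately have "{k. w' k \<noteq> 0} \<subset> ?T" by blast
    then have "card {k. w' k \<noteq> 0} < card ?T" using T psubset_card_mono by blast
    from less.hyps[OF this feas] obtain w'' where w'': "lp_feasible K E a b w''"
      "independent_columns K E a {k. w'' k \<noteq> 0}" "(\<Sum>k\<in>K. c k * w'' k) \<le> (\<Sum>k\<in>K. c k * w' k)" by blast
    have "(\<Sum>k\<in>K. c k * w' k) = (\<Sum>k\<in>K. c k * w k) + t * (\<Sum>k\<in>K. c k * v k)"
      by (simp add: w'_def sum_distrib_left algebra_simps flip: sum.distrib)
    also have "\<dots> \<le> (\<Sum>k\<in>K. c k * w k)" using t v(4) by (simp add: mult_nonneg_nonpos)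
    finally show ?thesis using w'' by force
  qed
qed

lemma independent_support_determines_solution:
  assumes "lp_feasible K E a b w" "lp_feasible K E a b w'" "{k. w k \<noteq> 0} = {k. w' k \<noteq> 0}"
    and ind: "independent_columns K E a {k. w k \<noteq> 0}"
  shows "w = w'"
proof -
  have "\<forall>k. k \<notin> {k. w k \<noteq> 0} \<longrightarrow> w k - w' k = 0" using assms(3) by auto
  moreover have "\<forall>e\<in>E. (\<Sum>k\<in>K. a e k * (w k - w' k)) = 0"
    using assms(1,2) by (simp add: lp_feasible_def right_diff_distrib sum_subtractf)
  ultimately have "\<forall>k. w k - w' k = 0"
    using ind[unfolded independent_columns_def, THEN spec[of _ "\<lambda>k. w k - w' k"]] by blast
  then show ?thesis by auto
qed

text \<open>Every feasible point is dominated by a basic one, and there are only finitely many basic ones, since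
  each is determined by its support. So a cheapest basic solution exists and is optimal.\<close>

theorem lp_optimal_sparse_solution:
  assumes K: "finite K" and E: "finite E" and c: "\<And>k. k \<in> K \<Longrightarrow> 0 \<le> c k"
    and w0: "lp_feasible K E a b w0"
  shows "\<exists>w. lp_feasible K E a b w \<and> card {k. w k \<noteq> 0} \<le> card E \<and>
    (\<forall>w'. lp_feasible K E a b w' \<longrightarrow> (\<Sum>k\<in>K. c k * w k) \<le> (\<Sum>k\<in>K. c k * w' k))"
proof -
  define V where "V = {w. lp_feasible K E a b w \<and> independent_columns K E a {k. w k \<noteq> 0}}"
  have sub: "{k. w k \<noteq> 0} \<subseteq> K" if "lp_feasible K E a b w" for w
    using that by (auto simp: lp_feasible_def)
  have "inj_on (\<lambda>w. {k. w k \<noteq> 0}) V"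
    using independent_support_determines_solution[of K E a b]
    by (intro inj_onI) (simp add: V_def)
  moreover have "(\<lambda>w. {k. w k \<noteq> 0}) ` V \<subseteq> Pow K" using sub by (auto simp: V_def)
  ultimately have "finite V" using K by (meson finite_Pow_iff inj_on_finite)
  moreover have "V \<noteq> {}" using lp_reduce_to_independent_support[of K c, OF K c w0] by (auto simp: V_def)
  ultimately obtain w where w: "w \<in> V"
    "\<And>w'. w' \<in> V \<Longrightarrow> (\<Sum>k\<in>K. c k * w k) \<le> (\<Sum>k\<in>K. c k * w' k)"
    using ex_is_arg_min_if_finite[of V "\<lambda>w. \<Sum>k\<in>K. c k * w k"]
    by (auto simp: is_arg_min_linorder)
  have "(\<Sum>k\<in>K. c k * w k) \<le> (\<Sum>k\<in>K. c k * w' k)" if "lp_feasible K E a b w'" for w'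
    using lp_reduce_to_independent_support[of K c, OF K c that] w(2) by (force simp: V_def)
  moreover have "card {k. w k \<noteq> 0} \<le> card E"
    using w(1) sub independent_columns_card_le[OF K E] by (auto simp: V_def)
  ultimately show ?thesis using w(1) by (auto simp: V_def)
qed

section \<open>Multimarginal transport plans\<close>

definition has_marginals :: "'i set \<Rightarrow> ('i \<Rightarrow> 'b set) \<Rightarrow> ('i \<Rightarrow> 'b \<Rightarrow> real) \<Rightarrow> (('i \<Rightarrow> 'b) \<Rightarrow> real) \<Rightarrow> bool" where
  "has_marginals I S d w \<longleftrightarrow> (\<forall>k. 0 \<le> w k) \<and> (\<forall>k. k \<notin> PiE I S \<longrightarrow> w k = 0) \<and>
     (\<forall>i\<in>I. \<forall>p\<in>S i. (\<Sum>k\<in>PiE I S. of_bool (k i = p) * w k) = d i p)"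

text \<open>Each tuple is counted exactly once, at the value of its \<open>i\<close>-th entry. Hence every marginal of a
  weight has the same total mass, which is the source of the redundancy among the equations.\<close>

lemma sum_marginal:
  assumes "finite I" "\<And>i. i \<in> I \<Longrightarrow> finite (S i)" "i \<in> I"
  shows "(\<Sum>p\<in>S i. \<Sum>k\<in>PiE I S. of_bool (k i = p) * w k) = (\<Sum>k\<in>PiE I S. (w k :: real))"
proof -
  have "(\<Sum>p\<in>S i. \<Sum>k\<in>PiE I S. of_bool (k i = p) * w k) =
        (\<Sum>k\<in>PiE I S. \<Sum>p\<in>S i. of_bool (k i = p) * w k)" by (rule sum.swap)
  also have "\<dots> = (\<Sum>k\<in>PiE I S. w k)"
  proof (rule sum.cong[OF refl])
    fix k assume "k \<in> PiE I S"
    then have "k i \<in> S i" using assms by auto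
    then show "(\<Sum>p\<in>S i. of_bool (k i = p) * w k) = w k"
      using assms by (simp add: of_bool_def if_distrib[of "\<lambda>x. x * _"] cong: if_cong)
  qed
  finally show ?thesis .
qed

lemma has_marginals_total:
  assumes "finite I" "\<And>i. i \<in> I \<Longrightarrow> finite (S i)" "i \<in> I" "has_marginals I S d w"
  shows "(\<Sum>k\<in>PiE I S. w k) = (\<Sum>p\<in>S i. d i p)"
  using sum_marginal[of I S i w] assms by (simp add: has_marginals_def)

text \<open>The sparse solution theorem is applied to a reduced system: for every index except one index \<open>j\<close>,
  the equation at one point \<open>q i\<close> is dropped. The full family at \<open>j\<close> fixes the total mass, and the
  total mass together with the remaining equations at \<open>i\<close> gives back the equation at \<open>q i\<close>.\<close>

theorem multimarginal_optimal_sparse_plan: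
  fixes c :: "('i \<Rightarrow> 'b) \<Rightarrow> real" and S :: "'i \<Rightarrow> 'b set"
  assumes I: "finite I" "I \<noteq> {}" and S: "\<And>i. i \<in> I \<Longrightarrow> finite (S i)"
    and d: "\<And>i. i \<in> I \<Longrightarrow> (\<Sum>p\<in>S i. d i p) = 1"
    and c: "\<And>k. k \<in> PiE I S \<Longrightarrow> 0 \<le> c k" and w0: "has_marginals I S d w0"
  shows "\<exists>w. has_marginals I S d w \<and> card {k. w k \<noteq> 0} + card I \<le> (\<Sum>i\<in>I. card (S i)) + 1 \<and>
    (\<forall>w'. has_marginals I S d w' \<longrightarrow> (\<Sum>k\<in>PiE I S. c k * w k) \<le> (\<Sum>k\<in>PiE I S. c k * w' k))"
proof -
  obtain j where j: "j \<in> I" using I by blast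
  have ne: "S i \<noteq> {}" if "i \<in> I" for i using d[OF that] by auto
  define q where "q i = (SOME p. p \<in> S i)" for i
  have q: "q i \<in> S i" if "i \<in> I" for i using ne[OF that] by (simp add: q_def some_in_eq)
  define F where "F i = (if i = j then S i else S i - {q i})" for i
  define E where "E = Sigma I F"
  define a :: "'i \<times> 'b \<Rightarrow> ('i \<Rightarrow> 'b) \<Rightarrow> real" where "a = (\<lambda>(i, p) k. of_bool (k i = p))"
  define b where "b = (\<lambda>(i, p). d i p)"
  have K: "finite (PiE I S)" using I S by (simp add: finite_PiE)
  have finE: "finite E" using I S unfolding E_def F_def by (intro finite_SigmaI) auto
  have "card E = (\<Sum>i\<in>I. card (F i))" using I S by (simp add: E_def F_def)
  also have "\<dots> = card (S j) + (\<Sum>i\<in>I - {j}. card (S i) - 1)"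
    using I j q S by (subst sum.remove[of I j]) (auto simp: F_def intro!: sum.cong)
  finally have "card E + card (I - {j}) = card (S j) + (\<Sum>i\<in>I - {j}. (card (S i) - 1) + 1)"
    by (simp add: sum_Suc del: card_Diff_insert)
  also have "(\<Sum>i\<in>I - {j}. (card (S i) - 1) + 1) = (\<Sum>i\<in>I - {j}. card (S i))"
    using ne S by (intro sum.cong) (auto simp: Suc_le_eq card_gt_0_iff)
  finally have cardE: "card E + card I = (\<Sum>i\<in>I. card (S i)) + 1"
    using card.remove[OF I(1) j] sum.remove[OF I(1) j, of "\<lambda>i. card (S i)"] by linarith
  have iff: "has_marginals I S d w \<longleftrightarrow> lp_feasible (PiE I S) E a b w" for w
  proof
    assume "has_marginals I S d w"
    then show "lp_feasible (PiE I S) E a b w"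
      by (auto simp: has_marginals_def lp_feasible_def E_def F_def a_def b_def split: if_splits)
  next
    assume w: "lp_feasible (PiE I S) E a b w"
    let ?m = "\<lambda>i p. \<Sum>k\<in>PiE I S. of_bool (k i = p) * w k"
    have F: "?m i p = d i p" if "i \<in> I" "p \<in> F i" for i p
      using w that by (auto simp: lp_feasible_def E_def a_def b_def)
    have total: "(\<Sum>p\<in>S i. ?m i p) = (\<Sum>k\<in>PiE I S. w k)" if "i \<in> I" for i
      using sum_marginal[of I S i w] I S that by blast
    have one: "(\<Sum>k\<in>PiE I S. w k) = 1"
      using total[OF j] F[OF j] d[OF j] by (simp add: F_def)
    have "?m i p = d i p" if i: "i \<in> I" and p: "p \<in> S i" for i p
    proof (cases "p \<in> F i")
      case False
      then have p: "p = q i" "F i = S i - {q i}" using p by (auto simp: F_def split: if_splits)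
      have "?m i (q i) + (\<Sum>p\<in>F i. ?m i p) = d i (q i) + (\<Sum>p\<in>F i. d i p)"
        using total[OF i] one d[OF i]
          sum.remove[OF S[OF i] q[OF i], of "?m i"] sum.remove[OF S[OF i] q[OF i], of "d i"]
        unfolding p by linarith
      then show ?thesis using F[OF i] by (simp add: p(1))
    qed (use F i in blast)
    then show "has_marginals I S d w" using w by (simp add: has_marginals_def lp_feasible_def)
  qed
  from lp_optimal_sparse_solution[of "PiE I S" E c a b w0, OF K finE c] w0
  obtain w where w: "lp_feasible (PiE I S) E a b w" "card {k. w k \<noteq> 0} \<le> card E"
    "\<forall>w'. lp_feasible (PiE I S) E a b w' \<longrightarrow> (\<Sum>k\<in>PiE I S. c k * w k) \<le> (\<Sum>k\<in>PiE I S. c k * w' k)"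
    unfolding iff by blast
  then show ?thesis using cardE unfolding iff by (intro exI[of _ w]) auto
qed

section \<open>Measures carried by finite sets\<close>

text \<open>The complement of the support is a union of null open sets, and by the Lindelof property a
  countable union suffices.\<close>

lemma emeasure_compl_measure_support:
  fixes M :: "'a::second_countable_topology measure"
  assumes M: "sets M = sets borel"
  shows "emeasure M (- measure_support M) = 0"
proof -
  define \<F> where "\<F> = {U. open U \<and> emeasure M U = 0}"
  obtain \<G> where G: "\<G> \<subseteq> \<F>" "countable \<G>" "\<Union>\<G> = \<Union>\<F>"
    using Lindelof[of \<F>] by (auto simp: \<F>_def)
  have "- measure_support M = (\<Union>U\<in>\<G>. U)"
    using G(3) by (auto simp: measure_support_def \<F>_def)
  moreover have "(\<Union>U\<in>\<G>. U) \<in> null_sets M"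
    using G(1,2) M by (intro null_sets_UN') (auto simp: \<F>_def null_sets_def)
  ultimately show ?thesis by auto
qed

lemma measure_support_subset:
  fixes M :: "'a::t1_space measure"
  assumes "finite S" "emeasure M (- S) = 0"
  shows "measure_support M \<subseteq> S"
proof
  fix x assume x: "x \<in> measure_support M"
  have "open (- S)" using assms(1) by (simp add: finite_imp_closed open_Compl)
  with x assms(2) show "x \<in> S" by (auto simp: measure_support_def)
qed

lemma nn_integral_finite_carrier:
  fixes M :: "'a::{second_countable_topology, t1_space} measure"
  assumes M: "sets M = sets borel" and S: "finite S" "emeasure M (- S) = 0"
    and f[measurable]: "f \<in> borel_measurable borel"
  shows "(\<integral>\<^sup>+x. f x \<partial>M) = (\<Sum>p\<in>S. f p * emeasure M {p})"
proof -
  have sp: "space M = UNIV" using sets_eq_imp_space_eq[OF M] by simp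
  have [measurable_cong]: "sets M = sets borel" by fact
  have "- S \<in> sets borel" using S(1) by (intro borel_open) (simp add: finite_imp_closed open_Compl)
  then have "- S \<in> null_sets M" using S M by (simp add: null_sets_def)
  then have "AE x in M. x \<in> S" using AE_not_in by force
  then have "(\<integral>\<^sup>+x. f x \<partial>M) = (\<integral>\<^sup>+x. (\<Sum>p\<in>S. f p * indicator {p} x) \<partial>M)"
    by (intro nn_integral_cong_AE, eventually_elim)
       (simp add: S(1) indicator_def of_bool_def if_distrib[of "\<lambda>x. _ * x"] cong: if_cong)
  also have "\<dots> = (\<Sum>p\<in>S. f p * emeasure M {p})"
    by (subst nn_integral_sum) (auto simp: nn_integral_cmult_indicator M)
  finally show ?thesis .
qed

lemma emeasure_finite_carrier:
  fixes M :: "'a::{second_countable_topology, t1_space} measure"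
  assumes M: "sets M = sets borel" and S: "finite S" "emeasure M (- S) = 0" and A: "A \<in> sets borel"
  shows "emeasure M A = (\<Sum>p\<in>S. indicator A p * emeasure M {p})"
proof -
  have "emeasure M A = (\<integral>\<^sup>+x. indicator A x \<partial>M)" using A M by simp
  also have "\<dots> = (\<Sum>p\<in>S. indicator A p * emeasure M {p})"
    using A by (intro nn_integral_finite_carrier[OF M S]) simp
  finally show ?thesis .
qed

lemma discrete_prob_measure_finite_carrier:
  fixes M :: "'a::second_countable_topology measure"
  assumes "discrete_prob_measure M"
  shows "prob_space M" "sets M = sets borel" "finite (measure_support M)"
    "emeasure M (- measure_support M) = 0"
  using assms emeasure_compl_measure_support[of M]
  by (simp_all add: discrete_prob_measure_def prob_measures_def)

section \<open>Gluing couplings along a common marginal\<close>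

lemma couplingsD:
  assumes "\<gamma> \<in> couplings Q P"
  shows "prob_space \<gamma>" "sets \<gamma> = sets borel" "distr \<gamma> borel fst = Q" "distr \<gamma> borel snd = P"
proof -
  have "\<gamma> \<in> prob_measures" "distr \<gamma> borel fst = Q" "distr \<gamma> borel snd = P"
    using assms[unfolded couplings_def, THEN CollectD] by simp_all
  then show "prob_space \<gamma>" "sets \<gamma> = sets borel" "distr \<gamma> borel fst = Q" "distr \<gamma> borel snd = P"
    by (simp_all add: prob_measures_def)
qed

text \<open>The weight \<open>f p y\<close> is the conditional probability that the second component equals \<open>p\<close> when the
  first one equals \<open>y\<close>. The part of \<open>\<gamma>\<close> on which the second component is \<open>p\<close> has a first marginal
  below \<open>Q\<close>, hence a density \<open>f p\<close>. As there are finitely many \<open>p\<close>, this replaces a general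
  disintegration theorem.\<close>

lemma coupling_conditional_weights:
  fixes Q P :: "'a::euclidean_space measure"
  assumes Q: "Q \<in> prob_measures" and S: "finite S" "emeasure P (- S) = 0"
    and \<gamma>: "\<gamma> \<in> couplings Q P"
  obtains f :: "'a \<Rightarrow> 'a \<Rightarrow> ennreal" where
    "\<And>p. f p \<in> borel_measurable borel"
    "AE y in Q. (\<Sum>p\<in>S. f p y) = 1"
    "\<And>p. (\<integral>\<^sup>+y. f p y \<partial>Q) = emeasure P {p}"
    "(\<integral>\<^sup>+(x, y). ennreal ((norm (x - y))\<^sup>2) \<partial>\<gamma>) =
       (\<integral>\<^sup>+y. (\<Sum>p\<in>S. f p y * ennreal ((norm (y - p))\<^sup>2)) \<partial>Q)"
proof -
  note c = couplingsD[OF \<gamma>]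
  have [measurable_cong]: "sets \<gamma> = sets borel" "sets Q = sets borel"
    using c Q by (auto simp: prob_measures_def)
  have [measurable]: "fst \<in> borel_measurable \<gamma>" "snd \<in> borel_measurable \<gamma>"
    using c(2) by (auto intro!: borel_measurable_continuous_onI continuous_intros simp: measurable_cong_sets[OF c(2) refl])
  interpret Q: prob_space Q using Q by (simp add: prob_measures_def)
  define \<nu> where "\<nu> p = distr (density \<gamma> (\<lambda>z. indicator {p} (snd z))) borel fst" for p
  have ind[measurable]: "(\<lambda>z. indicator {p} (snd z) :: ennreal) \<in> borel_measurable \<gamma>" for p
    by measurable
  have \<nu>: "(\<integral>\<^sup>+y. g y \<partial>\<nu> p) = (\<integral>\<^sup>+z. indicator {p} (snd z) * g (fst z) \<partial>\<gamma>)"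
    if [measurable]: "g \<in> borel_measurable borel" for g p
    unfolding \<nu>_def by (simp add: nn_integral_distr nn_integral_density)
  have Qint: "(\<integral>\<^sup>+y. g y \<partial>Q) = (\<integral>\<^sup>+z. g (fst z) \<partial>\<gamma>)"
    if [measurable]: "g \<in> borel_measurable borel" for g
    unfolding c(3)[symmetric] by (subst nn_integral_distr) auto
  have Pint: "(\<integral>\<^sup>+y. g y \<partial>P) = (\<integral>\<^sup>+z. g (snd z) \<partial>\<gamma>)"
    if [measurable]: "g \<in> borel_measurable borel" for g
    unfolding c(4)[symmetric] by (subst nn_integral_distr) auto
  have setsP: "sets P = sets borel" unfolding c(4)[symmetric] by simp
  have "absolutely_continuous Q (\<nu> p)" for p
    unfolding absolutely_continuous_def
  proof
    fix A assume A: "A \<in> null_sets Q"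
    then have [measurable]: "A \<in> sets borel" using \<open>sets Q = sets borel\<close> by (auto simp: null_sets_def)
    have "emeasure (\<nu> p) A = (\<integral>\<^sup>+z. indicator {p} (snd z) * indicator A (fst z) \<partial>\<gamma>)"
      using \<nu>[of "indicator A" p] by (simp add: \<nu>_def)
    also have "\<dots> \<le> (\<integral>\<^sup>+z. indicator A (fst z) \<partial>\<gamma>)"
      by (intro nn_integral_mono) (auto simp: indicator_def)
    also have "\<dots> = emeasure Q A" using Qint[of "indicator A"] by simp
    also have "\<dots> = 0" using A by auto
    finally show "A \<in> null_sets (\<nu> p)" by (auto simp: null_sets_def \<nu>_def)
  qed
  moreover have "sets (\<nu> p) = sets Q" for p by (simp add: \<nu>_def \<open>sets Q = sets borel\<close>)
  ultimately have "\<forall>p. \<exists>f\<in>borel_measurable Q. density Q f = \<nu> p" using Q.Radon_Nikodym by blast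
  then obtain f where f: "\<And>p. f p \<in> borel_measurable Q" "\<And>p. density Q (f p) = \<nu> p" by metis
  have [measurable]: "f p \<in> borel_measurable borel" for p
    using f(1)[of p] by (simp add: measurable_cong_sets[OF \<open>sets Q = sets borel\<close> refl])
  have key: "(\<integral>\<^sup>+y. f p y * g y \<partial>Q) = (\<integral>\<^sup>+z. indicator {p} (snd z) * g (fst z) \<partial>\<gamma>)"
    if [measurable]: "g \<in> borel_measurable borel" for g p
    using \<nu>[OF that, of p] by (simp add: f(2)[symmetric] nn_integral_density)
  have "AE y in P. y \<in> S"
  proof -
    have "- S \<in> sets borel" using S(1) by (intro borel_open) (simp add: finite_imp_closed open_Compl)
    then have "- S \<in> null_sets P" using S setsP by (simp add: null_sets_def)
    then show ?thesis using AE_not_in by force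
  qed
  then have AES: "AE z in \<gamma>. snd z \<in> S"
    using S(1) unfolding c(4)[symmetric]
    by (subst (asm) AE_distr_iff) (auto simp: finite_imp_closed)
  have AE1: "AE z in \<gamma>. (\<Sum>p\<in>S. indicator {p} (snd z) * h p z) = h (snd z) z"
    for h :: "'a \<Rightarrow> 'a \<times> 'a \<Rightarrow> ennreal"
    using AES by eventually_elim
      (simp add: S(1) indicator_def of_bool_def if_distrib[of "\<lambda>x. x * _"] cong: if_cong)
  have sums: "(\<integral>\<^sup>+y. (\<Sum>p\<in>S. f p y * g p y) \<partial>Q) = (\<integral>\<^sup>+z. g (snd z) (fst z) \<partial>\<gamma>)"
    if [measurable]: "\<And>p. g p \<in> borel_measurable borel" for g
  proof -
    have "(\<integral>\<^sup>+y. (\<Sum>p\<in>S. f p y * g p y) \<partial>Q) = (\<Sum>p\<in>S. \<integral>\<^sup>+z. indicator {p} (snd z) * g p (fst z) \<partial>\<gamma>)"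
      by (subst nn_integral_sum) (auto simp: key)
    also have "\<dots> = (\<integral>\<^sup>+z. (\<Sum>p\<in>S. indicator {p} (snd z) * g p (fst z)) \<partial>\<gamma>)"
      by (subst nn_integral_sum) auto
    also have "\<dots> = (\<integral>\<^sup>+z. g (snd z) (fst z) \<partial>\<gamma>)"
      by (intro nn_integral_cong_AE AE1[of "\<lambda>p z. g p (fst z)"])
    finally show ?thesis .
  qed
  \<comment> \<open>The pieces of \<open>\<gamma>\<close> add up to \<open>\<gamma>\<close>, whose first marginal is \<open>Q\<close>; uniqueness of densities does the rest.\<close>
  have "density Q (\<lambda>y. \<Sum>p\<in>S. f p y) = density Q (\<lambda>y. 1)"
  proof (rule measure_eqI)
    fix A assume "A \<in> sets (density Q (\<lambda>y. \<Sum>p\<in>S. f p y))"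
    then have [measurable]: "A \<in> sets borel" by (simp add: \<open>sets Q = sets borel\<close>)
    have "emeasure (density Q (\<lambda>y. \<Sum>p\<in>S. f p y)) A = (\<integral>\<^sup>+y. (\<Sum>p\<in>S. f p y * indicator A y) \<partial>Q)"
      by (subst emeasure_density) (auto simp: sum_distrib_right)
    also have "\<dots> = (\<integral>\<^sup>+y. indicator A y \<partial>Q)"
      unfolding Qint[OF borel_measurable_indicator[OF \<open>A \<in> sets borel\<close>]] by (subst sums) auto
    also have "\<dots> = emeasure (density Q (\<lambda>y. 1)) A"
      by (subst emeasure_density) auto
    finally show "emeasure (density Q (\<lambda>y. \<Sum>p\<in>S. f p y)) A = emeasure (density Q (\<lambda>y. 1)) A" .
  qed simp
  then have one: "AE y in Q. (\<Sum>p\<in>S. f p y) = 1"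
    by (subst (asm) Q.density_unique_iff) auto
  have mass: "(\<integral>\<^sup>+y. f p y \<partial>Q) = emeasure P {p}" for p
    using key[of "\<lambda>_. 1" p] Pint[of "indicator {p}"] setsP by simp
  have cost: "(\<integral>\<^sup>+(x, y). ennreal ((norm (x - y))\<^sup>2) \<partial>\<gamma>) =
       (\<integral>\<^sup>+y. (\<Sum>p\<in>S. f p y * ennreal ((norm (y - p))\<^sup>2)) \<partial>Q)"
    by (subst sums) (auto simp: case_prod_beta')
  show thesis by (rule that[of f]) (use one mass cost in auto)
qed

definition dispersion :: "'i set \<Rightarrow> ('i \<Rightarrow> 'a::real_inner) \<Rightarrow> real" where
  "dispersion I k = (\<Sum>i\<in>I. (norm ((\<Sum>j\<in>I. k j) /\<^sub>R real (card I) - k i))\<^sup>2)"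

text \<open>The bias-variance identity: the linear term vanishes around the mean, and passing from the mean to
  \<open>y\<close> adds \<open>card I * (norm (y - m))\<^sup>2\<close>.\<close>

lemma dispersion_le:
  fixes k :: "'i \<Rightarrow> 'a::real_inner"
  assumes "finite I" "I \<noteq> {}"
  shows "dispersion I k \<le> (\<Sum>i\<in>I. (norm (y - k i))\<^sup>2)"
proof -
  define m where "m = (\<Sum>j\<in>I. k j) /\<^sub>R real (card I)"
  have m: "(\<Sum>i\<in>I. m - k i) = 0"
    using assms by (simp add: m_def sum_subtractf sum_constant_scaleR)
  have "(\<Sum>i\<in>I. (norm (y - k i))\<^sup>2) =
      (\<Sum>i\<in>I. (norm (y - m))\<^sup>2 + 2 * ((y - m) \<bullet> (m - k i)) + (norm (m - k i))\<^sup>2)"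
    by (intro sum.cong refl)
       (simp add: power2_norm_eq_inner inner_diff_left inner_diff_right inner_commute algebra_simps)
  also have "\<dots> = card I * (norm (y - m))\<^sup>2 + 2 * ((y - m) \<bullet> (\<Sum>i\<in>I. m - k i)) + (\<Sum>i\<in>I. (norm (m - k i))\<^sup>2)"
    by (simp add: sum.distrib inner_sum_right sum_distrib_left)
  finally show ?thesis unfolding m by (simp add: dispersion_def m_def)
qed

text \<open>The plan is the mixture over \<open>y\<close> of the products of the conditional laws. Given \<open>y\<close>, the factors
  other than the \<open>i\<close>-th sum to one, so an expression in \<open>k i\<close> alone integrates as it does under the
  \<open>i\<close>-th coupling. This yields both the marginals and the cost, and replacing \<open>y\<close> by the mean of
  \<open>k\<close> only decreases the cost.\<close>

lemma glue_couplings: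
  fixes Q :: "'a::euclidean_space measure" and P :: "'i \<Rightarrow> 'a measure"
  assumes I: "finite I" "I \<noteq> {}" and Q: "Q \<in> prob_measures"
    and S: "\<And>i. i \<in> I \<Longrightarrow> finite (S i)" "\<And>i. i \<in> I \<Longrightarrow> emeasure (P i) (- S i) = 0"
    and \<gamma>: "\<And>i. i \<in> I \<Longrightarrow> \<gamma> i \<in> couplings Q (P i)"
  shows "\<exists>w. has_marginals I S (\<lambda>i p. measure (P i) {p}) w \<and>
     ennreal (\<Sum>k\<in>PiE I S. dispersion I k * w k)
       \<le> (\<Sum>i\<in>I. \<integral>\<^sup>+(x, y). ennreal ((norm (x - y))\<^sup>2) \<partial>\<gamma> i)"
proof -
  define W where "W i f \<longleftrightarrow> (\<forall>p. f p \<in> borel_measurable borel) \<and>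
    (AE y in Q. (\<Sum>p\<in>S i. f p y) = (1::ennreal)) \<and>
    (\<forall>p. (\<integral>\<^sup>+y. f p y \<partial>Q) = emeasure (P i) {p}) \<and>
    (\<integral>\<^sup>+(x, y). ennreal ((norm (x - y))\<^sup>2) \<partial>\<gamma> i) =
       (\<integral>\<^sup>+y. (\<Sum>p\<in>S i. f p y * ennreal ((norm (y - p))\<^sup>2)) \<partial>Q)" for i f
  have "\<forall>i\<in>I. \<exists>f. W i f"
  proof
    fix i assume i: "i \<in> I"
    show "\<exists>f. W i f"
      by (rule coupling_conditional_weights[OF Q S[OF i] \<gamma>[OF i]]) (unfold W_def, blast)
  qed
  then obtain f where W: "\<forall>i\<in>I. W i (f i)" by (rule bchoice[THEN exE])
  have f: "\<And>i p. i \<in> I \<Longrightarrow> f i p \<in> borel_measurable borel"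
    "\<And>i. i \<in> I \<Longrightarrow> AE y in Q. (\<Sum>p\<in>S i. f i p y) = 1"
    "\<And>i p. i \<in> I \<Longrightarrow> (\<integral>\<^sup>+y. f i p y \<partial>Q) = emeasure (P i) {p}"
    "\<And>i. i \<in> I \<Longrightarrow> (\<integral>\<^sup>+(x, y). ennreal ((norm (x - y))\<^sup>2) \<partial>\<gamma> i) =
       (\<integral>\<^sup>+y. (\<Sum>p\<in>S i. f i p y * ennreal ((norm (y - p))\<^sup>2)) \<partial>Q)"
    using W by (simp_all add: W_def)
  note [measurable] = f(1)
  have [measurable_cong]: "sets Q = sets borel" using Q by (auto simp: prob_measures_def)
  define g where "g k y = (\<Prod>i\<in>I. f i (k i) y)" for k y
  have g[measurable]: "g k \<in> borel_measurable borel" for k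
    unfolding g_def by measurable
  have K: "finite (PiE I S)" using I S by (simp add: finite_PiE)
  have AE1: "AE y in Q. \<forall>i\<in>I. (\<Sum>p\<in>S i. f i p y) = 1"
    using f(2) I(1) by (simp add: AE_finite_all)
  have marg: "(\<Sum>k\<in>PiE I S. h (k i) * g k y) = (\<Sum>p\<in>S i. h p * f i p y)"
    if i: "i \<in> I" and y: "\<forall>i\<in>I. (\<Sum>p\<in>S i. f i p y) = 1" for h i y
  proof -
    \<comment> \<open>The weight \<open>h (k i)\<close> is absorbed into the \<open>i\<close>-th factor, so that the sum over tuples becomes a product of sums.\<close>
    define r where "r j p = (if j = i then h p else 1) * f j p y" for j p
    have "(\<Sum>k\<in>PiE I S. h (k i) * g k y) = (\<Sum>k\<in>PiE I S. \<Prod>j\<in>I. r j (k j))"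
      using I(1) i by (intro sum.cong refl) (simp add: r_def g_def prod.distrib)
    also have "\<dots> = (\<Prod>j\<in>I. \<Sum>p\<in>S j. r j p)"
      using I(1) S(1) by (subst prod_sum_PiE) auto
    also have "\<dots> = (\<Prod>j\<in>I. if j = i then \<Sum>p\<in>S i. h p * f i p y else 1)"
      using y by (intro prod.cong refl) (auto simp: r_def)
    also have "\<dots> = (\<Sum>p\<in>S i. h p * f i p y)" using I(1) i by simp
    finally show ?thesis .
  qed
  define u where "u k = (\<integral>\<^sup>+y. g k y \<partial>Q)" for k
  have umarg: "(\<Sum>k\<in>PiE I S. of_bool (k i = p) * u k) = emeasure (P i) {p}"
    if i: "i \<in> I" and p: "p \<in> S i" for i p
  proof -
    have "(\<Sum>k\<in>PiE I S. of_bool (k i = p) * u k) = (\<integral>\<^sup>+y. (\<Sum>k\<in>PiE I S. of_bool (k i = p) * g k y) \<partial>Q)"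
      unfolding u_def by (subst nn_integral_sum) (auto simp: nn_integral_cmult)
    also have "\<dots> = (\<integral>\<^sup>+y. f i p y \<partial>Q)"
    proof (rule nn_integral_cong_AE, use AE1 in eventually_elim)
      case (elim y)
      show ?case using marg[OF i elim, of "\<lambda>q. of_bool (q = p)"] S(1)[OF i] p
        by (simp add: of_bool_def if_distrib[of "\<lambda>x. x * _"] cong: if_cong)
    qed
    finally show ?thesis using f(3)[OF i] by simp
  qed
  have P1: "emeasure (P i) {p} < \<infinity>" if i: "i \<in> I" for i p
  proof -
    note c = couplingsD[OF \<gamma>[OF i]]
    have "snd \<in> measurable (\<gamma> i) borel"
      unfolding measurable_cong_sets[OF c(2) refl]
      by (intro borel_measurable_continuous_onI continuous_intros)
    then have "prob_space (P i)" using prob_space.prob_space_distr[OF c(1)] c(4) by metis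
    then interpret prob_space "P i" .
    show ?thesis by (simp add: less_top[symmetric])
  qed
  have ufin: "u k < \<infinity>" if k: "k \<in> PiE I S" for k
  proof -
    obtain i where i: "i \<in> I" using I by blast
    have "u k = of_bool (k i = k i) * u k" by simp
    also have "\<dots> \<le> (\<Sum>k'\<in>PiE I S. of_bool (k' i = k i) * u k')"
      using K k by (intro member_le_sum) auto
    also have "\<dots> = emeasure (P i) {k i}" using umarg[OF i, of "k i"] k i by blast
    also have "\<dots> < \<infinity>" using P1[OF i] .
    finally show ?thesis .
  qed
  define w where "w k = (if k \<in> PiE I S then enn2real (u k) else 0)" for k
  have w: "ennreal (w k) = u k" "w k \<ge> 0" if "k \<in> PiE I S" for k
    using ufin[OF that] that by (auto simp: w_def)
  have "has_marginals I S (\<lambda>i p. measure (P i) {p}) w"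
    unfolding has_marginals_def
  proof (intro conjI ballI allI impI)
    fix i p assume i: "i \<in> I" and p: "p \<in> S i"
    have "ennreal (\<Sum>k\<in>PiE I S. of_bool (k i = p) * w k) =
        (\<Sum>k\<in>PiE I S. ennreal (of_bool (k i = p) * w k))"
      using w(2) by (intro sum_ennreal[symmetric]) simp
    also have "\<dots> = (\<Sum>k\<in>PiE I S. of_bool (k i = p) * u k)"
      using w by (intro sum.cong refl) (auto simp: of_bool_def)
    also have "\<dots> = ennreal (measure (P i) {p})"
      using umarg[OF i p] P1[OF i, of p] by (simp add: emeasure_eq_ennreal_measure)
    finally show "(\<Sum>k\<in>PiE I S. of_bool (k i = p) * w k) = measure (P i) {p}"
      using w by (subst (asm) ennreal_inj) (auto intro!: sum_nonneg)
  qed (auto simp: w_def)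
  moreover have "ennreal (\<Sum>k\<in>PiE I S. dispersion I k * w k)
       \<le> (\<Sum>i\<in>I. \<integral>\<^sup>+(x, y). ennreal ((norm (x - y))\<^sup>2) \<partial>\<gamma> i)"
  proof -
    have nn: "dispersion I k \<ge> 0" for k :: "'i \<Rightarrow> 'a" by (simp add: dispersion_def sum_nonneg)
    have "ennreal (\<Sum>k\<in>PiE I S. dispersion I k * w k) =
        (\<Sum>k\<in>PiE I S. ennreal (dispersion I k * w k))"
      using w(2) nn by (intro sum_ennreal[symmetric]) simp
    also have "\<dots> = (\<Sum>k\<in>PiE I S. ennreal (dispersion I k) * u k)"
      using w nn by (intro sum.cong refl) (simp add: ennreal_mult)
    also have "\<dots> = (\<integral>\<^sup>+y. (\<Sum>k\<in>PiE I S. ennreal (dispersion I k) * g k y) \<partial>Q)"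
      unfolding u_def by (subst nn_integral_sum) (auto simp: nn_integral_cmult)
    also have "\<dots> \<le> (\<integral>\<^sup>+y. (\<Sum>i\<in>I. \<Sum>p\<in>S i. f i p y * ennreal ((norm (y - p))\<^sup>2)) \<partial>Q)"
    proof (rule nn_integral_mono_AE, use AE1 in eventually_elim)
      case (elim y)
      have "(\<Sum>k\<in>PiE I S. ennreal (dispersion I k) * g k y)
          \<le> (\<Sum>k\<in>PiE I S. (\<Sum>i\<in>I. ennreal ((norm (y - k i))\<^sup>2)) * g k y)"
        using dispersion_le[OF I, of _ y] by (intro sum_mono mult_right_mono) (auto simp: sum_ennreal ennreal_leI)
      also have "\<dots> = (\<Sum>i\<in>I. \<Sum>k\<in>PiE I S. ennreal ((norm (y - k i))\<^sup>2) * g k y)"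
        by (subst sum.swap) (simp only: sum_distrib_right)
      also have "\<dots> = (\<Sum>i\<in>I. \<Sum>p\<in>S i. f i p y * ennreal ((norm (y - p))\<^sup>2))"
        using marg[OF _ elim, of _ "\<lambda>p. ennreal ((norm (y - p))\<^sup>2)"]
        by (intro sum.cong refl) (simp add: mult.commute)
      finally show ?case .
    qed
    also have "\<dots> = (\<Sum>i\<in>I. \<integral>\<^sup>+(x, y). ennreal ((norm (x - y))\<^sup>2) \<partial>\<gamma> i)"
      by (subst nn_integral_sum) (auto simp: f(4) intro!: borel_measurable_sum)
    finally show ?thesis .
  qed
  ultimately show ?thesis by blast
qed

section \<open>Wasserstein costs and plan costs\<close>

lemma finite_carrier_in_P2:
  fixes M :: "'a::euclidean_space measure"
  assumes M: "prob_space M" "sets M = sets borel" and S: "finite S" "emeasure M (- S) = 0"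
  shows "M \<in> P2"
proof -
  interpret prob_space M by fact
  have "(\<integral>\<^sup>+x. ennreal ((norm x)\<^sup>2) \<partial>M) = (\<Sum>p\<in>S. ennreal ((norm p)\<^sup>2) * emeasure M {p})"
    by (rule nn_integral_finite_carrier[OF M(2) S]) measurable
  also have "\<dots> < \<infinity>"
    using S(1) by (simp add: ennreal_mult_eq_top_iff less_top[symmetric])
  finally have "integrable M (\<lambda>x. (norm x)\<^sup>2)"
    by (intro integrableI_bounded) (auto simp: measurable_cong_sets[OF M(2) refl])
  then show ?thesis using M by (simp add: P2_def prob_measures_def)
qed

text \<open>The independent coupling has cost at most twice the sum of the second moments. This makes the
  infimum in \<^const>\<open>W2\<close> finite, so that the conversion from \<open>ennreal\<close> to \<open>real\<close> is faithful.\<close>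

lemma finite_cost_coupling:
  fixes P Q :: "'a::euclidean_space measure"
  assumes P: "P \<in> P2" and Q: "Q \<in> P2"
  shows "\<exists>\<gamma>\<in>couplings P Q. (\<integral>\<^sup>+(x, y). ennreal ((norm (x - y))\<^sup>2) \<partial>\<gamma>) < \<infinity>"
proof -
  have PQ: "prob_space P" "prob_space Q" "sets P = sets borel" "sets Q = sets borel"
    "integrable P (\<lambda>x. (norm x)\<^sup>2)" "integrable Q (\<lambda>x. (norm x)\<^sup>2)"
    using P Q by (simp_all add: P2_def prob_measures_def)
  note [measurable_cong] = PQ(3,4)
  interpret P: prob_space P by fact
  interpret Q: prob_space Q by fact
  interpret PQ: pair_prob_space P Q ..
  define \<gamma> where "\<gamma> = P \<Otimes>\<^sub>M Q"
  have sets: "sets \<gamma> = sets borel"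
    unfolding \<gamma>_def by (metis PQ(3,4) borel_prod sets_pair_measure_cong)
  have meas[measurable]: "fst \<in> borel_measurable \<gamma>" "snd \<in> borel_measurable \<gamma>"
    unfolding measurable_cong_sets[OF sets refl]
    by (intro borel_measurable_continuous_onI continuous_intros)+
  have space: "space P = UNIV" "space Q = UNIV" "space \<gamma> = UNIV"
    using sets_eq_imp_space_eq[OF PQ(3)] sets_eq_imp_space_eq[OF PQ(4)] sets_eq_imp_space_eq[OF sets]
    by simp_all
  have rect: "emeasure \<gamma> (A \<times> C) = emeasure P A * emeasure Q C"
    if "A \<in> sets borel" "C \<in> sets borel" for A C
    unfolding \<gamma>_def using that PQ(3,4) by (intro Q.emeasure_pair_measure_Times) simp_all
  have fst: "distr \<gamma> borel fst = P"
  proof (rule measure_eqI)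
    fix A assume "A \<in> sets (distr \<gamma> borel fst)"
    then have A: "A \<in> sets borel" by simp
    have "emeasure (distr \<gamma> borel fst) A = emeasure \<gamma> (A \<times> UNIV)"
      using A by (subst emeasure_distr) (auto simp: space intro!: arg_cong[of _ _ "emeasure \<gamma>"])
    also have "\<dots> = emeasure P A" using rect[OF A, of UNIV] Q.emeasure_space_1 space by simp
    finally show "emeasure (distr \<gamma> borel fst) A = emeasure P A" .
  qed (simp add: PQ)
  have snd: "distr \<gamma> borel snd = Q"
  proof (rule measure_eqI)
    fix A assume "A \<in> sets (distr \<gamma> borel snd)"
    then have A: "A \<in> sets borel" by simp
    have "emeasure (distr \<gamma> borel snd) A = emeasure \<gamma> (UNIV \<times> A)"
      using A by (subst emeasure_distr) (auto simp: space intro!: arg_cong[of _ _ "emeasure \<gamma>"])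
    also have "\<dots> = emeasure Q A" using rect[OF _ A, of UNIV] P.emeasure_space_1 space by simp
    finally show "emeasure (distr \<gamma> borel snd) A = emeasure Q A" .
  qed (simp add: PQ)
  have "\<gamma> \<in> couplings P Q"
    using sets fst snd by (simp add: couplings_def prob_measures_def \<gamma>_def PQ.prob_space_axioms)
  have fin: "(\<integral>\<^sup>+x. ennreal ((norm x)\<^sup>2) \<partial>M) < \<infinity>" if "integrable M (\<lambda>x. (norm x)\<^sup>2)"
    for M :: "'a measure"
    using that by (simp add: integrable_iff_bounded)
  have "(\<integral>\<^sup>+(x, y). ennreal ((norm (x - y))\<^sup>2) \<partial>\<gamma>) \<le>
      (\<integral>\<^sup>+z. 2 * ennreal ((norm (fst z))\<^sup>2) + 2 * ennreal ((norm (snd z))\<^sup>2) \<partial>\<gamma>)"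
  proof (rule nn_integral_mono)
    fix z :: "'a \<times> 'a"
    obtain x y where z: "z = (x, y)" by (cases z)
    have "(norm (x - y))\<^sup>2 \<le> (norm x + norm y)\<^sup>2"
      by (intro power_mono norm_triangle_ineq4) auto
    also have "\<dots> \<le> 2 * (norm x)\<^sup>2 + 2 * (norm y)\<^sup>2"
      using sum_squares_bound[of "norm x" "norm y"] by (simp add: power2_sum)
    finally have "ennreal ((norm (x - y))\<^sup>2) \<le> ennreal (2 * (norm x)\<^sup>2 + 2 * (norm y)\<^sup>2)"
      by (rule ennreal_leI)
    then show "(case z of (x, y) \<Rightarrow> ennreal ((norm (x - y))\<^sup>2))
        \<le> 2 * ennreal ((norm (fst z))\<^sup>2) + 2 * ennreal ((norm (snd z))\<^sup>2)"
      by (simp add: z ennreal_mult)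
  qed
  also have "\<dots> = 2 * (\<integral>\<^sup>+z. ennreal ((norm (fst z))\<^sup>2) \<partial>\<gamma>) + 2 * (\<integral>\<^sup>+z. ennreal ((norm (snd z))\<^sup>2) \<partial>\<gamma>)"
    by (subst nn_integral_add) (auto simp: nn_integral_cmult)
  also have "(\<integral>\<^sup>+z. ennreal ((norm (fst z))\<^sup>2) \<partial>\<gamma>) = (\<integral>\<^sup>+x. ennreal ((norm x)\<^sup>2) \<partial>distr \<gamma> borel fst)"
    by (subst nn_integral_distr) auto
  also have "(\<integral>\<^sup>+z. ennreal ((norm (snd z))\<^sup>2) \<partial>\<gamma>) = (\<integral>\<^sup>+x. ennreal ((norm x)\<^sup>2) \<partial>distr \<gamma> borel snd)"
    by (subst nn_integral_distr) auto
  also have "2 * (\<integral>\<^sup>+x. ennreal ((norm x)\<^sup>2) \<partial>distr \<gamma> borel fst) +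
      2 * (\<integral>\<^sup>+x. ennreal ((norm x)\<^sup>2) \<partial>distr \<gamma> borel snd) < \<infinity>"
    using fin[OF PQ(5)] fin[OF PQ(6)] unfolding fst snd by (simp add: ennreal_mult_less_top)
  finally show ?thesis using \<open>\<gamma> \<in> couplings P Q\<close> by blast
qed

lemma W2_squared:
  "(W2 P Q)\<^sup>2 = enn2real (INF \<gamma>\<in>couplings P Q. \<integral>\<^sup>+(x, y). ennreal ((norm (x - y))\<^sup>2) \<partial>\<gamma>)"
  by (simp add: W2_def)

lemma W2_squared_le:
  assumes "\<gamma> \<in> couplings P Q" "(\<integral>\<^sup>+(x, y). ennreal ((norm (x - y))\<^sup>2) \<partial>\<gamma>) \<le> ennreal c" "0 \<le> c"
  shows "(W2 P Q)\<^sup>2 \<le> c"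
  unfolding W2_squared
  using assms by (intro enn2real_leI) (auto intro: INF_lower2)

lemma near_optimal_coupling:
  fixes P Q :: "'a::euclidean_space measure"
  assumes "P \<in> P2" "Q \<in> P2" "e > 0"
  shows "\<exists>\<gamma>\<in>couplings P Q. (\<integral>\<^sup>+(x, y). ennreal ((norm (x - y))\<^sup>2) \<partial>\<gamma>) \<le> ennreal ((W2 P Q)\<^sup>2 + e)"
proof -
  define V where "V = (INF \<gamma>\<in>couplings P Q. \<integral>\<^sup>+(x, y). ennreal ((norm (x - y))\<^sup>2) \<partial>\<gamma>)"
  have "V < \<infinity>" using finite_cost_coupling[OF assms(1,2)] unfolding V_def INF_less_iff .
  then have V: "ennreal ((W2 P Q)\<^sup>2) = V" by (simp add: W2_squared V_def)
  have "ennreal ((W2 P Q)\<^sup>2) < ennreal ((W2 P Q)\<^sup>2 + e)"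
    using assms(3) by (intro ennreal_lessI) (auto intro: add_nonneg_pos)
  then have "V < ennreal ((W2 P Q)\<^sup>2 + e)" unfolding V .
  then show ?thesis unfolding V_def INF_less_iff by (blast intro: less_imp_le)
qed

text \<open>The infima defining the distances need not be known to be attained: near-optimal couplings are glued,
  with an error that is shared equally among the indices.\<close>

lemma plan_cost_le_W2:
  fixes Q :: "'a::euclidean_space measure" and P :: "'i \<Rightarrow> 'a measure"
  assumes I: "finite I" "I \<noteq> {}" and Q: "Q \<in> P2" and P: "\<And>i. i \<in> I \<Longrightarrow> P i \<in> P2"
    and S: "\<And>i. i \<in> I \<Longrightarrow> finite (S i)" "\<And>i. i \<in> I \<Longrightarrow> emeasure (P i) (- S i) = 0"
    and opt: "\<And>w. has_marginals I S (\<lambda>i p. measure (P i) {p}) w \<Longrightarrow>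
      L \<le> (\<Sum>k\<in>PiE I S. dispersion I k * w k)"
  shows "L \<le> (\<Sum>i\<in>I. (W2 Q (P i))\<^sup>2)"
proof (rule field_le_epsilon)
  fix e :: real assume "e > 0"
  define e' where "e' = e / real (card I)"
  have e': "e' > 0" using \<open>e > 0\<close> I by (simp add: e'_def card_gt_0_iff)
  obtain \<gamma> where \<gamma>: "\<And>i. i \<in> I \<Longrightarrow> \<gamma> i \<in> couplings Q (P i)"
    "\<And>i. i \<in> I \<Longrightarrow> (\<integral>\<^sup>+(x, y). ennreal ((norm (x - y))\<^sup>2) \<partial>\<gamma> i) \<le> ennreal ((W2 Q (P i))\<^sup>2 + e')"
    using near_optimal_coupling[OF Q P e'] by metis
  have "Q \<in> prob_measures" using Q by (simp add: P2_def)
  from glue_couplings[OF I this, of S P \<gamma>] S \<gamma>(1)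
  obtain w where w: "has_marginals I S (\<lambda>i p. measure (P i) {p}) w"
    "ennreal (\<Sum>k\<in>PiE I S. dispersion I k * w k)
       \<le> (\<Sum>i\<in>I. \<integral>\<^sup>+(x, y). ennreal ((norm (x - y))\<^sup>2) \<partial>\<gamma> i)" by blast
  have "ennreal L \<le> ennreal (\<Sum>k\<in>PiE I S. dispersion I k * w k)"
    using opt[OF w(1)] by (rule ennreal_leI)
  also have "\<dots> \<le> (\<Sum>i\<in>I. ennreal ((W2 Q (P i))\<^sup>2 + e'))"
    using w(2) sum_mono[of I, OF \<gamma>(2)] by (rule order_trans)
  also have "\<dots> = ennreal (\<Sum>i\<in>I. (W2 Q (P i))\<^sup>2 + e')"
    using e' by (intro sum_ennreal) simp
  finally have "L \<le> (\<Sum>i\<in>I. (W2 Q (P i))\<^sup>2 + e')"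
    using e' by (subst (asm) ennreal_le_iff) (auto intro!: sum_nonneg)
  also have "\<dots> = (\<Sum>i\<in>I. (W2 Q (P i))\<^sup>2) + e"
    using I by (simp add: sum.distrib e'_def)
  finally show "L \<le> (\<Sum>i\<in>I. (W2 Q (P i))\<^sup>2) + e" .
qed

section \<open>Existence of a sparse barycenter\<close>

text \<open>Under the law of a \<open>w\<close>-random tuple, the pair of the mean and the \<open>i\<close>-th entry has marginals \<open>B\<close> and
  \<open>P i\<close>. The costs of these couplings add up to the cost of the plan.\<close>

lemma mean_of_plan:
  fixes P :: "'i \<Rightarrow> 'a::euclidean_space measure"
  assumes I: "finite I" "I \<noteq> {}"
    and P: "\<And>i. i \<in> I \<Longrightarrow> prob_space (P i)" "\<And>i. i \<in> I \<Longrightarrow> sets (P i) = sets borel"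
    and S: "\<And>i. i \<in> I \<Longrightarrow> finite (S i)" "\<And>i. i \<in> I \<Longrightarrow> emeasure (P i) (- S i) = 0"
    and w: "has_marginals I S (\<lambda>i p. measure (P i) {p}) w"
    and tot: "(\<Sum>k\<in>PiE I S. w k) = 1"
  shows "\<exists>B\<in>P2. finite (measure_support B) \<and> card (measure_support B) \<le> card {k. w k \<noteq> 0} \<and>
    (\<Sum>i\<in>I. (W2 B (P i))\<^sup>2) \<le> (\<Sum>k\<in>PiE I S. dispersion I k * w k)"
proof -
  let ?K = "PiE I S"
  have K: "finite ?K" using I S by (simp add: finite_PiE)
  have w0: "\<And>k. 0 \<le> w k" "\<And>k. k \<notin> ?K \<Longrightarrow> w k = 0"
    "\<And>i p. i \<in> I \<Longrightarrow> p \<in> S i \<Longrightarrow> (\<Sum>k\<in>?K. of_bool (k i = p) * w k) = measure (P i) {p}"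
    using w by (auto simp: has_marginals_def)
  define \<omega> where "\<omega> = embed_pmf w"
  have int1: "(\<integral>\<^sup>+k. ennreal (w k) \<partial>count_space UNIV) = 1"
    using K w0 tot by (subst nn_integral_count_space'[of ?K]) auto
  have pmf: "pmf \<omega> k = w k" for k unfolding \<omega>_def using w0(1) int1 by (rule pmf_embed_pmf)
  have set: "set_pmf \<omega> = {k. w k \<noteq> 0}" unfolding \<omega>_def using w0(1) int1 by (rule set_embed_pmf)
  have int: "(\<integral>\<^sup>+k. g k \<partial>measure_pmf \<omega>) = (\<Sum>k\<in>?K. g k * ennreal (w k))" for g
    using K w0(2) by (subst nn_integral_measure_pmf_support[of ?K]) (auto simp: pmf set)
  have em: "emeasure (measure_pmf \<omega>) X = (\<Sum>k\<in>?K. indicator X k * ennreal (w k))" for X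
    using int[of "indicator X"] by simp
  have supp: "{k. w k \<noteq> 0} \<subseteq> ?K" "finite {k. w k \<noteq> 0}"
    using w0(2) K by (auto intro: finite_subset)
  define m where "m k = (\<Sum>j\<in>I. k j) /\<^sub>R real (card I)" for k :: "'i \<Rightarrow> 'a"
  define B where "B = distr (measure_pmf \<omega>) borel m"
  have B: "prob_space B" "sets B = sets borel"
    unfolding B_def by (auto intro!: measure_pmf.prob_space_distr)
  define R where "R = m ` {k. w k \<noteq> 0}"
  have R: "finite R" "card R \<le> card {k. w k \<noteq> 0}"
    using supp(2) by (auto simp: R_def card_image_le)
  have "- R \<in> sets borel" using R(1) by (intro borel_open) (simp add: finite_imp_closed open_Compl)
  then have "emeasure B (- R) = emeasure (measure_pmf \<omega>) (m -` (- R))"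
    unfolding B_def by (subst emeasure_distr) auto
  also have "\<dots> = 0" unfolding em by (intro sum.neutral) (auto simp: R_def indicator_def)
  finally have BR: "emeasure B (- R) = 0" .
  have "B \<in> P2" using finite_carrier_in_P2[OF B R(1) BR] .
  moreover have "finite (measure_support B)" "card (measure_support B) \<le> card {k. w k \<noteq> 0}"
    using measure_support_subset[OF R(1) BR] R finite_subset card_mono[of R "measure_support B"]
    by (auto intro: finite_subset)
  moreover have "(\<Sum>i\<in>I. (W2 B (P i))\<^sup>2) \<le> (\<Sum>k\<in>?K. dispersion I k * w k)"
  proof -
    have "(W2 B (P i))\<^sup>2 \<le> (\<Sum>k\<in>?K. (norm (m k - k i))\<^sup>2 * w k)" if i: "i \<in> I" for i
    proof (rule W2_squared_le)
      interpret Pi: prob_space "P i" using P(1)[OF i] .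
      define D where "D = distr (measure_pmf \<omega>) borel (\<lambda>k. k i)"
      have D: "emeasure D A = (\<Sum>k\<in>?K. indicator A (k i) * ennreal (w k))" if "A \<in> sets borel" for A
        using that unfolding D_def
        by (subst emeasure_distr) (auto simp: em indicator_def intro!: sum.cong)
      have setsD: "sets D = sets borel" by (simp add: D_def)
      have "- S i \<in> sets borel"
        using S(1)[OF i] by (intro borel_open) (simp add: finite_imp_closed open_Compl)
      then have DS: "emeasure D (- S i) = 0"
        using i by (subst D) (auto intro!: sum.neutral simp: indicator_def)
      have single: "emeasure D {p} = emeasure (P i) {p}" if p: "p \<in> S i" for p
      proof -
        have "emeasure D {p} = (\<Sum>k\<in>?K. ennreal (of_bool (k i = p) * w k))"
          by (subst D) (auto intro!: sum.cong simp: indicator_def)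
        also have "\<dots> = ennreal (\<Sum>k\<in>?K. of_bool (k i = p) * w k)"
          using w0(1) by (intro sum_ennreal) simp
        also have "\<dots> = emeasure (P i) {p}"
          unfolding w0(3)[OF i p] by (simp add: Pi.emeasure_eq_measure)
        finally show ?thesis .
      qed
      \<comment> \<open>Both measures are carried by \<open>S i\<close> and agree on its points.\<close>
      have "D = P i"
      proof (rule measure_eqI)
        show "sets D = sets (P i)" using setsD P(2)[OF i] by simp
        fix A assume "A \<in> sets D"
        then have A: "A \<in> sets borel" by (simp add: setsD)
        show "emeasure D A = emeasure (P i) A"
          unfolding emeasure_finite_carrier[OF setsD S(1)[OF i] DS A]
            emeasure_finite_carrier[OF P(2)[OF i] S(1)[OF i] S(2)[OF i] A]
          using single by (intro sum.cong refl) simp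
      qed
      define \<gamma> where "\<gamma> = distr (measure_pmf \<omega>) borel (\<lambda>k. (m k, k i))"
      have [measurable]: "fst \<in> borel_measurable (borel :: ('a \<times> 'a) measure)"
        "snd \<in> borel_measurable (borel :: ('a \<times> 'a) measure)"
        by (intro borel_measurable_continuous_onI continuous_intros)+
      have "distr \<gamma> borel fst = B" "distr \<gamma> borel snd = P i"
        unfolding \<gamma>_def \<open>D = P i\<close>[symmetric] B_def D_def
        by (subst distr_distr; simp add: comp_def)+
      then show "\<gamma> \<in> couplings B (P i)"
        unfolding couplings_def prob_measures_def \<gamma>_def
        by (auto intro!: measure_pmf.prob_space_distr)
      have "(\<integral>\<^sup>+(x, y). ennreal ((norm (x - y))\<^sup>2) \<partial>\<gamma>) = (\<integral>\<^sup>+k. ennreal ((norm (m k - k i))\<^sup>2) \<partial>measure_pmf \<omega>)"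
        unfolding \<gamma>_def case_prod_beta' by (subst nn_integral_distr) auto
      also have "\<dots> = (\<Sum>k\<in>?K. ennreal ((norm (m k - k i))\<^sup>2 * w k))"
        unfolding int using w0(1) by (intro sum.cong refl) (simp add: ennreal_mult)
      also have "\<dots> = ennreal (\<Sum>k\<in>?K. (norm (m k - k i))\<^sup>2 * w k)"
        using w0(1) by (intro sum_ennreal) simp
      finally show "(\<integral>\<^sup>+(x, y). ennreal ((norm (x - y))\<^sup>2) \<partial>\<gamma>)
          \<le> ennreal (\<Sum>k\<in>?K. (norm (m k - k i))\<^sup>2 * w k)" by simp
      show "0 \<le> (\<Sum>k\<in>?K. (norm (m k - k i))\<^sup>2 * w k)" using w0(1) by (intro sum_nonneg) simp
    qed
    then have "(\<Sum>i\<in>I. (W2 B (P i))\<^sup>2) \<le> (\<Sum>i\<in>I. \<Sum>k\<in>?K. (norm (m k - k i))\<^sup>2 * w k)"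
      by (rule sum_mono)
    also have "\<dots> = (\<Sum>k\<in>?K. dispersion I k * w k)"
      unfolding dispersion_def m_def sum_distrib_right by (rule sum.swap)
    finally show ?thesis .
  qed
  ultimately show ?thesis by blast
qed

text \<open>Some plan must be exhibited before a cheapest one can be taken; gluing arbitrary couplings of one
  of the \<open>P j\<close> with all the others provides it.\<close>

theorem sparse_barycenter:
  fixes P :: "'i \<Rightarrow> 'a::euclidean_space measure"
  assumes I: "finite I" "I \<noteq> {}" and P: "\<And>i. i \<in> I \<Longrightarrow> discrete_prob_measure (P i)"
  shows "\<exists>B\<in>P2. (\<forall>Q\<in>P2. (\<Sum>i\<in>I. (W2 B (P i))\<^sup>2) \<le> (\<Sum>i\<in>I. (W2 Q (P i))\<^sup>2)) \<and>
    finite (measure_support B) \<and>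
    card (measure_support B) + card I \<le> (\<Sum>i\<in>I. card (measure_support (P i))) + 1"
proof -
  define S where "S i = measure_support (P i)" for i
  define d where "d i p = measure (P i) {p}" for i p
  have P': "prob_space (P i)" "sets (P i) = sets borel" "finite (S i)" "emeasure (P i) (- S i) = 0"
    if "i \<in> I" for i
    using discrete_prob_measure_finite_carrier[OF P[OF that]] by (simp_all add: S_def)
  have P2: "P i \<in> P2" if "i \<in> I" for i using finite_carrier_in_P2[OF P'[OF that]] .
  have d: "(\<Sum>p\<in>S i. d i p) = 1" if i: "i \<in> I" for i
  proof -
    interpret prob_space "P i" using P'(1)[OF i] .
    have "1 = (\<Sum>p\<in>S i. ennreal (d i p))"
      using emeasure_finite_carrier[OF P'(2)[OF i] P'(3)[OF i] P'(4)[OF i], of UNIV]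
        emeasure_space_1 sets_eq_imp_space_eq[OF P'(2)[OF i]]
      by (simp add: d_def emeasure_eq_measure)
    also have "\<dots> = ennreal (\<Sum>p\<in>S i. d i p)" by (intro sum_ennreal) (simp add: d_def)
    finally show ?thesis by simp
  qed
  have prob: "\<gamma> \<in> prob_measures" if "\<gamma> \<in> P2" for \<gamma> :: "'a measure" using that by (simp add: P2_def)
  obtain j where j: "j \<in> I" using I by blast
  obtain \<gamma> where \<gamma>: "\<And>i. i \<in> I \<Longrightarrow> \<gamma> i \<in> couplings (P j) (P i)"
    using finite_cost_coupling[OF P2[OF j] P2] by metis
  from glue_couplings[OF I prob[OF P2[OF j]], of S P \<gamma>] P' \<gamma>
  obtain w0 where w0: "has_marginals I S d w0" unfolding d_def by blast
  obtain w where w: "has_marginals I S d w" "card {k. w k \<noteq> 0} + card I \<le> (\<Sum>i\<in>I. card (S i)) + 1"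
    "\<And>w'. has_marginals I S d w' \<Longrightarrow>
      (\<Sum>k\<in>PiE I S. dispersion I k * w k) \<le> (\<Sum>k\<in>PiE I S. dispersion I k * w' k)"
    using multimarginal_optimal_sparse_plan[of I S d "dispersion I" w0, OF I P'(3) d _ w0]
    by (auto simp: dispersion_def sum_nonneg)
  have "(\<Sum>k\<in>PiE I S. w k) = 1"
    using has_marginals_total[of I S j d w] I P'(3) j w(1) d[OF j] by simp
  then obtain B where B: "B \<in> P2" "finite (measure_support B)"
    "card (measure_support B) \<le> card {k. w k \<noteq> 0}"
    "(\<Sum>i\<in>I. (W2 B (P i))\<^sup>2) \<le> (\<Sum>k\<in>PiE I S. dispersion I k * w k)"
    using mean_of_plan[of I P S w] I P' w(1) unfolding d_def by blast
  have "(\<Sum>i\<in>I. (W2 B (P i))\<^sup>2) \<le> (\<Sum>i\<in>I. (W2 Q (P i))\<^sup>2)" if Q: "Q \<in> P2" for Q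
    using plan_cost_le_W2[of I Q P S "\<Sum>k\<in>PiE I S. dispersion I k * w k"]
      I Q P2 P' w(3) B(4) unfolding d_def by fastforce
  with B w(2) show ?thesis unfolding S_def by fastforce
qed

theorem theorem2:
  fixes P :: "nat \<Rightarrow> (real ^ 'd) measure" and N :: nat
  assumes "N \<ge> 1"
    and "\<And>i. i \<in> {1..N} \<Longrightarrow> discrete_prob_measure (P i)"
  shows "\<exists>B. is_barycenter N P B \<and> finite (measure_support B) \<and>
    int (card (measure_support B)) \<le> (\<Sum>i=1..N. int (card (measure_support (P i)))) - int N + 1"
proof -
  obtain B where B: "B \<in> P2" "finite (measure_support B)"
    "\<And>Q. Q \<in> P2 \<Longrightarrow> (\<Sum>i=1..N. (W2 B (P i))\<^sup>2) \<le> (\<Sum>i=1..N. (W2 Q (P i))\<^sup>2)"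
    "card (measure_support B) + N \<le> (\<Sum>i=1..N. card (measure_support (P i))) + 1"
    using sparse_barycenter[of "{1..N}" P] assms by auto
  have "(\<Sum>i=1..N. (W2 B (P i))\<^sup>2) = (INF Q\<in>P2. \<Sum>i=1..N. (W2 Q (P i))\<^sup>2)"
  proof (rule antisym)
    show "(\<Sum>i=1..N. (W2 B (P i))\<^sup>2) \<le> (INF Q\<in>P2. \<Sum>i=1..N. (W2 Q (P i))\<^sup>2)"
      using B(1,3) by (intro cINF_greatest) auto
    show "(INF Q\<in>P2. \<Sum>i=1..N. (W2 Q (P i))\<^sup>2) \<le> (\<Sum>i=1..N. (W2 B (P i))\<^sup>2)"
      using B(1) by (intro cINF_lower bdd_belowI[of _ 0]) (auto intro: sum_nonneg)
  qed
  then have "is_barycenter N P B" using B(1) by (simp add: is_barycenter_def)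
  moreover have "int (card (measure_support B)) \<le>
      (\<Sum>i=1..N. int (card (measure_support (P i)))) - int N + 1"
    using B(4) unfolding of_nat_sum[symmetric] by linarith
  ultimately show ?thesis using B(2) by blast
qed

end
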